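(* Let $A\in\mathbb{C}^{2\times2}$ be a non-singular matrix with $A=VCV^{-1}$, where $$C=\begin{pmatrix}a_+&0\\ 0&a_-\end{pmatrix},\qquad V=\begin{pmatrix}v_1&v_2\\ v_3&v_4\end{pmatrix}.$$ For $\lambda\in\mathbb{C}$ put $$B_\lambda=\begin{pmatrix}0&I\\ -\lambda^2C^{-1}&0\end{pmatrix}\in\mathbb{C}^{4\times4},\qquad \Psi=\begin{pmatrix}v_1&v_2&0&0\\ 0&0&v_3&v_4\end{pmatrix}\in\mathbb{C}^{2\times4}.$$ Then $\lambda$ is an eigenvalue of the system $\Phi'=B_\lambda\Phi$ on $[0,1]$, $\Psi\Phi(0)=\Psi\Phi(1)=0$, if and only if $EV(\lambda)=0$, where $$EV(x)=2v_1v_2v_3v_4\left[1-\cos\left(\frac{x}{\sqrt{a_+}}\right)\cos\left(\frac{x}{\sqrt{a_-}}\right)\right]-\left[v_1^2v_4^2\frac{\sqrt{a_+}}{\sqrt{a_-}}+v_2^2v_3^2\frac{\sqrt{a_-}}{\sqrt{a_+}}\right]\sin\left(\frac{x}{\sqrt{a_+}}\right)\sin\left(\frac{x}{\sqrt{a_-}}\right).$$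
   Context: $\lambda\in\mathbb{C}$ is called an eigenvalue of the system if there exists a smooth function $\Phi:[0,1]\to\mathbb{C}^4$, not identically zero, with $\Phi'(x)=B_\lambda\Phi(x)$ and $\Psi\Phi(0)=\Psi\Phi(1)=0$. Here $\sqrt{a_+}$ and $\sqrt{a_-}$ denote fixed choices of complex square roots. (The system is the first-order form, via $\Phi=(g,g')$ and $f=Vg$, of the problem $-Af''=\lambda^2f$ for $f=\begin{pmatrix}\phi\\ \gamma\end{pmatrix}$ with $\phi(0)=\phi(1)=0$, $\gamma'(0)=\gamma'(1)=0$.) *)

theory Defs
  imports "HOL-Analysis.Analysis"
begin

lemma vector_4 [simp]:
  "(vector [x, y, z, w] :: 'a::zero^4) $ 1 = x"
  "(vector [x, y, z, w] :: 'a::zero^4) $ 2 = y"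
  "(vector [x, y, z, w] :: 'a::zero^4) $ 3 = z"
  "(vector [x, y, z, w] :: 'a::zero^4) $ 4 = w"
  unfolding vector_def by simp_all

definition Cmat :: "complex \<Rightarrow> complex \<Rightarrow> complex^2^2" where
  "Cmat ap am = vector [vector [ap, 0], vector [0, am]]"

definition Vmat :: "complex \<Rightarrow> complex \<Rightarrow> complex \<Rightarrow> complex \<Rightarrow> complex^2^2" where
  "Vmat v1 v2 v3 v4 = vector [vector [v1, v2], vector [v3, v4]]"

definition block_matrix ::
  "complex^2^2 \<Rightarrow> complex^2^2 \<Rightarrow> complex^2^2 \<Rightarrow> complex^2^2 \<Rightarrow> complex^4^4" where
  "block_matrix P Q R S = vector
     [vector [P$1$1, P$1$2, Q$1$1, Q$1$2],
      vector [P$2$1, P$2$2, Q$2$1, Q$2$2],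
      vector [R$1$1, R$1$2, S$1$1, S$1$2],
      vector [R$2$1, R$2$2, S$2$1, S$2$2]]"

definition Bmat :: "complex^2^2 \<Rightarrow> complex \<Rightarrow> complex^4^4" where
  "Bmat C l = block_matrix 0 (mat 1) (\<chi> i j. - (l^2) * matrix_inv C $ i $ j) 0"

definition Psimat :: "complex \<Rightarrow> complex \<Rightarrow> complex \<Rightarrow> complex \<Rightarrow> complex^4^2" where
  "Psimat v1 v2 v3 v4 = vector [vector [v1, v2, 0, 0], vector [0, 0, v3, v4]]"

text \<open>Infinitely differentiable on \<^term>\<open>S\<close>: \<^term>\<open>D n\<close> is the \<open>n\<close>-th derivative.
  Derivatives are taken within \<^term>\<open>S\<close>, so they are one-sided at the endpoints of a
  closed interval.\<close>

definition smooth_on :: "real set \<Rightarrow> (real \<Rightarrow> 'a::real_normed_vector) \<Rightarrow> bool" where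
  "smooth_on S f \<longleftrightarrow> (\<exists>D :: nat \<Rightarrow> real \<Rightarrow> 'a.
     (\<forall>x\<in>S. D 0 x = f x) \<and>
     (\<forall>n. \<forall>x\<in>S. (D n has_vector_derivative D (Suc n) x) (at x within S)))"

definition system_eigenvalue ::
  "(complex \<Rightarrow> complex^4^4) \<Rightarrow> complex^4^2 \<Rightarrow> complex \<Rightarrow> bool" where
  "system_eigenvalue B \<Psi> l \<longleftrightarrow> (\<exists>\<Phi> :: real \<Rightarrow> complex^4.
     smooth_on {0..1} \<Phi> \<and>
     (\<exists>x\<in>{0..1}. \<Phi> x \<noteq> 0) \<and>
     (\<forall>x\<in>{0..1}. (\<Phi> has_vector_derivative (B l *v \<Phi> x)) (at x within {0..1})) \<and>
     \<Psi> *v \<Phi> 0 = 0 \<and> \<Psi> *v \<Phi> 1 = 0)"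

text \<open>The arguments \<open>sp\<close> and \<open>sm\<close> are the chosen square roots of the two diagonal
  entries of \<open>C\<close>.\<close>

definition EV ::
  "complex \<Rightarrow> complex \<Rightarrow> complex \<Rightarrow> complex \<Rightarrow> complex \<Rightarrow> complex \<Rightarrow> complex \<Rightarrow> complex" where
  "EV v1 v2 v3 v4 sp sm x =
     2 * v1 * v2 * v3 * v4 * (1 - cos (x / sp) * cos (x / sm))
     - (v1^2 * v4^2 * (sp / sm) + v2^2 * v3^2 * (sm / sp)) * sin (x / sp) * sin (x / sm)"

end

theory Submission
  imports Defs
begin

text \<open>Decoupled, the system consists of two harmonic oscillators of frequencies
  \<open>p = \<lambda> / \<surd>a\<^sub>+\<close> and \<open>q = \<lambda> / \<surd>a\<^sub>-\<close>, solved by sines and cosines when \<open>\<lambda> \<noteq> 0\<close>. The two boundary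
  conditions at 0 leave one free parameter for the cosine coefficients and one for the sine
  coefficients; the conditions at 1 then form a homogeneous \<open>2 \<times> 2\<close> system whose determinant is
  \<open>p q EV(\<lambda>)\<close>. For \<open>\<lambda> = 0\<close> a constant solution exists and \<open>EV(0) = 0\<close>.\<close>

section \<open>Smoothness and coordinatewise differentiation\<close>

text \<open>A bounded linear map commutes with differentiation, so iterating the equation gives
  \<open>(B ^^ n) (\<Phi> x)\<close> as the \<open>n\<close>-th derivative. Hence smoothness of a
  candidate eigenfunction follows from the differential equation alone.\<close>

lemma smooth_on_linear_ode:
  fixes B :: "'a::real_normed_vector \<Rightarrow> 'a"
  assumes "bounded_linear B"
    and "\<And>x. x \<in> S \<Longrightarrow> (\<Phi> has_vector_derivative B (\<Phi> x)) (at x within S)"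
  shows "smooth_on S \<Phi>"
proof -
  define D where "D n x = (B ^^ n) (\<Phi> x)" for n x
  have "(D n has_vector_derivative D (Suc n) x) (at x within S)" if "x \<in> S" for n x
  proof (induction n)
    case 0
    then show ?case
      using assms(2)[OF that] by (simp add: D_def)
  next
    case (Suc n)
    have "D (Suc m) = (\<lambda>x. B (D m x))" for m
      by (simp add: D_def fun_eq_iff)
    then show ?case
      using bounded_linear.has_vector_derivative[OF assms(1) Suc.IH] by simp
  qed
  then show ?thesis
    unfolding smooth_on_def by (intro exI[of _ D]) (auto simp: D_def)
qed

lemma has_vector_derivative_vec_nth_iff:
  fixes f :: "real \<Rightarrow> 'a::euclidean_space^'n"
  shows "(f has_vector_derivative d) (at x within S) \<longleftrightarrow>
    (\<forall>i. ((\<lambda>x. f x $ i) has_vector_derivative d $ i) (at x within S))"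
proof
  assume "(f has_vector_derivative d) (at x within S)"
  then show "\<forall>i. ((\<lambda>x. f x $ i) has_vector_derivative d $ i) (at x within S)"
    by (auto intro: bounded_linear.has_vector_derivative[OF bounded_linear_vec_nth])
next
  assume "\<forall>i. ((\<lambda>x. f x $ i) has_vector_derivative d $ i) (at x within S)"
  then show "(f has_vector_derivative d) (at x within S)"
    unfolding has_vector_derivative_def
    by (subst has_derivative_componentwise_within)
      (auto simp: Basis_vec_def inner_axis intro!: derivative_eq_intros)
qed

section \<open>The scalar harmonic oscillator\<close>

text \<open>Rotating the phase vector \<open>(w * f x, h x)\<close> back by the angle
  \<open>w * x\<close> gives a constant vector; undoing the rotation recovers both formulas. This
  works for complex \<open>w\<close>, where no energy argument is at hand.\<close>

lemma oscillator_solution: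
  fixes f h :: "real \<Rightarrow> complex"
  assumes f: "\<forall>x\<in>{0..1}. (f has_vector_derivative h x) (at x within {0..1})"
    and h: "\<forall>x\<in>{0..1}. (h has_vector_derivative - w\<^sup>2 * f x) (at x within {0..1})"
    and w: "w \<noteq> 0" and x: "x \<in> {0..1}"
  shows "f x = f 0 * cos (w * x) + h 0 / w * sin (w * x)"
    and "h x = w * (h 0 / w * cos (w * x) - f 0 * sin (w * x))"
proof -
  have c: "((\<lambda>x. cos (w * of_real x)) has_vector_derivative - w * sin (w * x)) (at x within S)"
    for x :: real and S
    by (rule has_vector_derivative_real_field[unfolded o_def])
       (auto intro!: derivative_eq_intros)
  have s: "((\<lambda>x. sin (w * of_real x)) has_vector_derivative w * cos (w * x)) (at x within S)"
    for x :: real and S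
    by (rule has_vector_derivative_real_field[unfolded o_def])
       (auto intro!: derivative_eq_intros)
  \<comment> \<open>First coordinate of the rotated phase vector; the second is treated below in the
    same way.\<close>
  have "((\<lambda>x. w * f x * cos (w * x) - h x * sin (w * x)) has_vector_derivative 0)
      (at x within {0..1})" if "x \<in> {0..1}" for x
    using that
    by (auto intro!: derivative_eq_intros f[rule_format] h[rule_format] c s simp: algebra_simps power2_eq_square)
  then obtain a where a: "\<And>x. x \<in> {0..1} \<Longrightarrow> w * f x * cos (w * x) - h x * sin (w * x) = a"
    by (rule has_vector_derivative_zero_constant[rotated]) auto
  have "((\<lambda>x. w * f x * sin (w * x) + h x * cos (w * x)) has_vector_derivative 0)
      (at x within {0..1})" if "x \<in> {0..1}" for x
    using that
    by (auto intro!: derivative_eq_intros f[rule_format] h[rule_format] c s simp: algebra_simps power2_eq_square)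
  then obtain b where b: "\<And>x. x \<in> {0..1} \<Longrightarrow> w * f x * sin (w * x) + h x * cos (w * x) = b"
    by (rule has_vector_derivative_zero_constant[rotated]) auto
  have ab: "a = w * f 0" "b = h 0"
    using a[of 0] b[of 0] by auto
  \<comment> \<open>Inserting the factor 1 in this form inverts the rotation.\<close>
  have "w * f x = w * f x * ((sin (w * x))\<^sup>2 + (cos (w * x))\<^sup>2)"
    by simp
  also have "\<dots> = a * cos (w * x) + b * sin (w * x)"
    unfolding a[OF x, symmetric] b[OF x, symmetric]
    by algebra
  finally have "w * f x = a * cos (w * x) + b * sin (w * x)" .
  then show "f x = f 0 * cos (w * x) + h 0 / w * sin (w * x)"
    using w by (simp add: ab field_simps)
  have "h x = h x * ((sin (w * x))\<^sup>2 + (cos (w * x))\<^sup>2)"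
    by simp
  also have "\<dots> = b * cos (w * x) - a * sin (w * x)"
    unfolding a[OF x, symmetric] b[OF x, symmetric]
    by algebra
  finally have "h x = b * cos (w * x) - a * sin (w * x)" .
  then show "h x = w * (h 0 / w * cos (w * x) - f 0 * sin (w * x))"
    using w by (simp add: ab right_diff_distrib)
qed

section \<open>Linear algebra of the boundary conditions\<close>

lemma homogeneous_equation_solutions:
  fixes a b x y :: "'a::field"
  assumes "a \<noteq> 0 \<or> b \<noteq> 0"
  shows "a * x + b * y = 0 \<longleftrightarrow> (\<exists>t. x = t * b \<and> y = - t * a)"
proof
  assume eq: "a * x + b * y = 0"
  show "\<exists>t. x = t * b \<and> y = - t * a"
  proof (cases "b = 0")
    case True
    then show ?thesis
      using assms eq by (intro exI[of _ "- y / a"]) auto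
  next
    case False
    then have "y = - (a * x) / b"
      using eq by (simp add: field_simps add_eq_0_iff)
    then show ?thesis
      using False by (intro exI[of _ "x / b"]) auto
  qed
qed (auto simp: algebra_simps)

text \<open>Elimination shows that the determinant annihilates each unknown. Conversely,
  \<open>(b, - a)\<close> always solves the first equation, and the second when the determinant
  vanishes, so only a zero first row needs separate care.\<close>

lemma homogeneous_system_nontrivial_iff:
  fixes a b c d :: "'a::field"
  shows "(\<exists>t u. (t \<noteq> 0 \<or> u \<noteq> 0) \<and> a * t + b * u = 0 \<and> c * t + d * u = 0) \<longleftrightarrow> a * d - b * c = 0"
proof
  assume "\<exists>t u. (t \<noteq> 0 \<or> u \<noteq> 0) \<and> a * t + b * u = 0 \<and> c * t + d * u = 0"
  then obtain t u where tu: "t \<noteq> 0 \<or> u \<noteq> 0" "a * t + b * u = 0" "c * t + d * u = 0"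
    by blast
  then have "(a * d - b * c) * t = 0" "(a * d - b * c) * u = 0"
    by algebra+
  with tu(1) show "a * d - b * c = 0"
    by auto
next
  assume det: "a * d - b * c = 0"
  show "\<exists>t u. (t \<noteq> 0 \<or> u \<noteq> 0) \<and> a * t + b * u = 0 \<and> c * t + d * u = 0"
  proof (cases "a = 0 \<and> b = 0")
    case True
    then show ?thesis
      by (cases "c = 0 \<and> d = 0")
        (auto intro: exI[of _ 1] exI[of _ d] exI[of _ "- c"] simp: algebra_simps,
         (metis (no_types) add.right_inverse mult.commute mult_minus_right)+)
  next
    case False
    then show ?thesis
      using det by (intro exI[of _ b] exI[of _ "- a"]) (auto simp: algebra_simps)
  qed
qed

text \<open>Here \<open>c\<close>, \<open>s\<close>, \<open>d\<close>, \<open>t\<close> stand for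
  the cosine and sine of \<open>p\<close> and of \<open>q\<close>; the elimination is purely
  algebraic and uses no trigonometric identity.\<close>

lemma boundary_system_nontrivial_iff:
  fixes v1 v2 v3 v4 p q c s d t :: complex
  assumes V: "v1 * v4 - v2 * v3 \<noteq> 0" and p: "p \<noteq> 0" and q: "q \<noteq> 0"
  shows "(\<exists>\<alpha> \<beta> \<gamma> \<delta>. \<not> (\<alpha> = 0 \<and> \<beta> = 0 \<and> \<gamma> = 0 \<and> \<delta> = 0) \<and>
      v1 * \<alpha> + v2 * \<gamma> = 0 \<and>
      v3 * (p * \<beta>) + v4 * (q * \<delta>) = 0 \<and>
      v1 * (\<alpha> * c + \<beta> * s) + v2 * (\<gamma> * d + \<delta> * t) = 0 \<and>
      v3 * (p * (\<beta> * c - \<alpha> * s)) + v4 * (q * (\<delta> * d - \<gamma> * t)) = 0) \<longleftrightarrow>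
    v1 * v2 * v3 * v4 * p * q * (c - d)\<^sup>2
      - (v1 * v4 * q * s - v2 * v3 * p * t) * (v1 * v4 * q * t - v2 * v3 * p * s) = 0"
    (is "?L \<longleftrightarrow> ?R")
proof -
  \<comment> \<open>No row of a nonsingular matrix vanishes, so each condition at 0 has a
    one-dimensional solution space.\<close>
  have 1: "v1 \<noteq> 0 \<or> v2 \<noteq> 0" "v3 * p \<noteq> 0 \<or> v4 * q \<noteq> 0"
    using V p q by auto
  have sol1: "v1 * \<alpha> + v2 * \<gamma> = 0 \<longleftrightarrow> (\<exists>x. \<alpha> = x * v2 \<and> \<gamma> = - x * v1)" for \<alpha> \<gamma>
    by (rule homogeneous_equation_solutions[OF 1(1)])
  have sol2: "v3 * (p * \<beta>) + v4 * (q * \<delta>) = 0 \<longleftrightarrow>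
      (\<exists>y. \<beta> = y * (v4 * q) \<and> \<delta> = - y * (v3 * p))" for \<beta> \<delta>
    using homogeneous_equation_solutions[OF 1(2)] by (simp add: mult.assoc)
  have "?L \<longleftrightarrow> (\<exists>x y. (x \<noteq> 0 \<or> y \<noteq> 0) \<and>
      v1 * v2 * (c - d) * x + (v1 * v4 * q * s - v2 * v3 * p * t) * y = 0 \<and>
      (v1 * v4 * q * t - v2 * v3 * p * s) * x + v3 * v4 * p * q * (c - d) * y = 0)"
    (is "_ \<longleftrightarrow> (\<exists>x y. ?P x y)")
  proof
    assume ?L
    then obtain \<alpha> \<beta> \<gamma> \<delta> where
      nz: "\<not> (\<alpha> = 0 \<and> \<beta> = 0 \<and> \<gamma> = 0 \<and> \<delta> = 0)" and
      e12: "v1 * \<alpha> + v2 * \<gamma> = 0" "v3 * (p * \<beta>) + v4 * (q * \<delta>) = 0" and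
      e3: "v1 * (\<alpha> * c + \<beta> * s) + v2 * (\<gamma> * d + \<delta> * t) = 0" and
      e4: "v3 * (p * (\<beta> * c - \<alpha> * s)) + v4 * (q * (\<delta> * d - \<gamma> * t)) = 0"
      by blast
    obtain x y where xy: "\<alpha> = x * v2" "\<gamma> = - x * v1" "\<beta> = y * (v4 * q)" "\<delta> = - y * (v3 * p)"
      using e12 unfolding sol1 sol2 by blast
    have "?P x y"
      using nz e3 e4 unfolding xy by (auto simp: algebra_simps)
    then show "\<exists>x y. ?P x y"
      by blast
  next
    assume "\<exists>x y. ?P x y"
    then obtain x y where xy: "?P x y"
      by blast
    \<comment> \<open>The spanning vectors \<open>(v2, - v1)\<close> and
      \<open>(v4 * q, - v3 * p)\<close> are nonzero, so a nontrivial pair \<open>x\<close>,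
      \<open>y\<close> gives nontrivial coefficients.\<close>
    show ?L
      by (rule exI[of _ "x * v2"], rule exI[of _ "y * (v4 * q)"],
          rule exI[of _ "- x * v1"], rule exI[of _ "- y * (v3 * p)"])
        (use xy V p q in \<open>auto simp: algebra_simps\<close>)
  qed
  also have "\<dots> \<longleftrightarrow> ?R"
    unfolding homogeneous_system_nontrivial_iff by (simp add: algebra_simps power2_eq_square)
  finally show ?thesis .
qed

section \<open>The concrete matrices in coordinates\<close>

lemma det_Vmat: "det (Vmat v1 v2 v3 v4) = v1 * v4 - v2 * v3"
  by (simp add: det_2 Vmat_def)

lemma det_Cmat: "det (Cmat ap am) = ap * am"
  by (simp add: det_2 Cmat_def)

lemma matrix_inv_eqI:
  fixes A :: "'a::semiring_1^'n^'m"
  assumes "A ** X = mat 1" "X ** A = mat 1"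
  shows "matrix_inv A = X"
proof -
  \<comment> \<open>\<open>matrix_inv\<close> is a choice among two-sided inverses; \<open>X\<close>
    witnesses that there is one to choose.\<close>
  have "A ** matrix_inv A = mat 1 \<and> matrix_inv A ** A = mat 1"
    unfolding matrix_inv_def by (rule someI[of _ X]) (use assms in auto)
  then have "matrix_inv A ** (A ** X) = X"
    by (simp add: matrix_mul_assoc)
  then show ?thesis
    by (simp add: assms)
qed

lemma matrix_inv_Cmat:
  assumes "ap \<noteq> 0" "am \<noteq> 0"
  shows "matrix_inv (Cmat ap am) = Cmat (1 / ap) (1 / am)"
  by (rule matrix_inv_eqI)
    (use assms in \<open>auto simp: Cmat_def vec_eq_iff forall_2 matrix_matrix_mult_def sum_2 mat_def\<close>)

lemma Bmat_mult_vector: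
  assumes "ap \<noteq> 0" "am \<noteq> 0"
  shows "Bmat (Cmat ap am) l *v z
    = vector [z $ 3, z $ 4, - (l\<^sup>2 / ap) * z $ 1, - (l\<^sup>2 / am) * z $ 2]"
  unfolding Bmat_def matrix_inv_Cmat[OF assms]
  by (simp add: vec_eq_iff forall_4 matrix_vector_mult_def sum_4 block_matrix_def mat_def Cmat_def)

lemma Psimat_mult_vector_eq_0_iff:
  "Psimat v1 v2 v3 v4 *v z = 0 \<longleftrightarrow>
    v1 * z $ 1 + v2 * z $ 2 = 0 \<and> v3 * z $ 3 + v4 * z $ 4 = 0"
  by (simp add: vec_eq_iff forall_2 matrix_vector_mult_def sum_4 Psimat_def)

section \<open>From eigenfunctions to coefficients\<close>

lemma system_eigenvalueI:
  assumes "\<And>x. x \<in> {0..1} \<Longrightarrow> (\<Phi> has_vector_derivative (B l *v \<Phi> x)) (at x within {0..1})"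
    and "x \<in> {0..1}" "\<Phi> x \<noteq> 0" "\<Psi> *v \<Phi> 0 = 0" "\<Psi> *v \<Phi> 1 = 0"
  shows "system_eigenvalue B \<Psi> l"
  unfolding system_eigenvalue_def
  using assms smooth_on_linear_ode[OF matrix_vector_mul_bounded_linear assms(1)] by blast

lemma system_eigenvalue_0:
  assumes "v1 * v4 - v2 * v3 \<noteq> 0" "ap \<noteq> 0" "am \<noteq> 0"
  shows "system_eigenvalue (Bmat (Cmat ap am)) (Psimat v1 v2 v3 v4) 0"
proof (rule system_eigenvalueI[where x = 0])
  \<comment> \<open>The zero lower half makes this vector a constant solution when \<lambda> = 0,
    and \<open>(v2, - v1)\<close> is annihilated by the first row of \<open>V\<close>.\<close>
  let ?\<Phi> = "\<lambda>x :: real. vector [v2, - v1, 0, 0] :: complex^4"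
  show "(?\<Phi> has_vector_derivative (Bmat (Cmat ap am) 0 *v ?\<Phi> x)) (at x within {0..1})" for x
    using assms by (simp add: Bmat_mult_vector has_vector_derivative_vec_nth_iff forall_4)
  show "?\<Phi> 0 \<noteq> 0"
    using assms(1) by (auto simp: vec_eq_iff forall_4)
qed (auto simp: Psimat_mult_vector_eq_0_iff)

text \<open>Only the squares of \<open>p\<close> and \<open>q\<close> enter the differential
  equation, so either square root serves as a frequency. The four unknowns are the constants of
  integration.\<close>

lemma system_eigenvalue_iff:
  assumes p: "p \<noteq> 0" "p\<^sup>2 = l\<^sup>2 / ap" and q: "q \<noteq> 0" "q\<^sup>2 = l\<^sup>2 / am"
    and a: "ap \<noteq> 0" "am \<noteq> 0"
  shows "system_eigenvalue (Bmat (Cmat ap am)) (Psimat v1 v2 v3 v4) l \<longleftrightarrow>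
    (\<exists>\<alpha> \<beta> \<gamma> \<delta>. \<not> (\<alpha> = 0 \<and> \<beta> = 0 \<and> \<gamma> = 0 \<and> \<delta> = 0) \<and>
      v1 * \<alpha> + v2 * \<gamma> = 0 \<and>
      v3 * (p * \<beta>) + v4 * (q * \<delta>) = 0 \<and>
      v1 * (\<alpha> * cos p + \<beta> * sin p) + v2 * (\<gamma> * cos q + \<delta> * sin q) = 0 \<and>
      v3 * (p * (\<beta> * cos p - \<alpha> * sin p)) + v4 * (q * (\<delta> * cos q - \<gamma> * sin q)) = 0)"
    (is "?L \<longleftrightarrow> ?R")
proof
  assume ?L
  then obtain \<Phi> where nz: "\<exists>x\<in>{0..1}. \<Phi> x \<noteq> 0"
    and ode: "\<And>x. x \<in> {0..1} \<Longrightarrow>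
      (\<Phi> has_vector_derivative (Bmat (Cmat ap am) l *v \<Phi> x)) (at x within {0..1})"
    and bc: "Psimat v1 v2 v3 v4 *v \<Phi> 0 = 0" "Psimat v1 v2 v3 v4 *v \<Phi> 1 = 0"
    unfolding system_eigenvalue_def by blast
  \<comment> \<open>Coordinates 1 and 3 are position and velocity of the oscillator of frequency
    \<open>p\<close>; coordinates 2 and 4 belong to \<open>q\<close>.\<close>
  have comp: "\<forall>x\<in>{0..1}. ((\<lambda>x. \<Phi> x $ 1) has_vector_derivative \<Phi> x $ 3) (at x within {0..1})"
    "\<forall>x\<in>{0..1}. ((\<lambda>x. \<Phi> x $ 3) has_vector_derivative - p\<^sup>2 * \<Phi> x $ 1) (at x within {0..1})"
    "\<forall>x\<in>{0..1}. ((\<lambda>x. \<Phi> x $ 2) has_vector_derivative \<Phi> x $ 4) (at x within {0..1})"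
    "\<forall>x\<in>{0..1}. ((\<lambda>x. \<Phi> x $ 4) has_vector_derivative - q\<^sup>2 * \<Phi> x $ 2) (at x within {0..1})"
    using ode
    by (simp_all add: has_vector_derivative_vec_nth_iff forall_4 Bmat_mult_vector[OF a] p q)
  note sol = oscillator_solution[OF comp(1,2) p(1)] oscillator_solution[OF comp(3,4) q(1)]
  define \<alpha> \<beta> \<gamma> \<delta> where "\<alpha> = \<Phi> 0 $ 1" and "\<beta> = \<Phi> 0 $ 3 / p"
    and "\<gamma> = \<Phi> 0 $ 2" and "\<delta> = \<Phi> 0 $ 4 / q"
  note defs = this
  have "\<not> (\<alpha> = 0 \<and> \<beta> = 0 \<and> \<gamma> = 0 \<and> \<delta> = 0)"
  proof
    assume zero: "\<alpha> = 0 \<and> \<beta> = 0 \<and> \<gamma> = 0 \<and> \<delta> = 0"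
    have "\<Phi> x = 0" if "x \<in> {0..1}" for x
      using sol[OF that, folded defs] zero by (simp add: vec_eq_iff forall_4)
    then show False
      using nz by blast
  qed
  moreover have "v1 * \<alpha> + v2 * \<gamma> = 0" "v3 * (p * \<beta>) + v4 * (q * \<delta>) = 0"
    using bc(1) p(1) q(1) by (auto simp: Psimat_mult_vector_eq_0_iff defs)
  moreover have "v1 * (\<alpha> * cos p + \<beta> * sin p) + v2 * (\<gamma> * cos q + \<delta> * sin q) = 0"
    "v3 * (p * (\<beta> * cos p - \<alpha> * sin p)) + v4 * (q * (\<delta> * cos q - \<gamma> * sin q)) = 0"
    using bc(2) sol[of 1, folded defs] by (auto simp: Psimat_mult_vector_eq_0_iff)
  ultimately show ?R
    by blast
next
  assume ?R
  then obtain \<alpha> \<beta> \<gamma> \<delta> where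
    nz: "\<not> (\<alpha> = 0 \<and> \<beta> = 0 \<and> \<gamma> = 0 \<and> \<delta> = 0)" and
    e: "v1 * \<alpha> + v2 * \<gamma> = 0" "v3 * (p * \<beta>) + v4 * (q * \<delta>) = 0"
      "v1 * (\<alpha> * cos p + \<beta> * sin p) + v2 * (\<gamma> * cos q + \<delta> * sin q) = 0"
      "v3 * (p * (\<beta> * cos p - \<alpha> * sin p)) + v4 * (q * (\<delta> * cos q - \<gamma> * sin q)) = 0"
    by blast
  \<comment> \<open>The general oscillation and its velocity; their derivatives come from complex
    differentiation restricted to the real line.\<close>
  define f h where "f w a b x = a * cos (w * of_real x) + b * sin (w * of_real x)"
    and "h w a b x = w * (b * cos (w * of_real x) - a * sin (w * of_real x))"
    for w a b :: complex and x :: real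
  have f: "(f w a b has_vector_derivative h w a b x) (at x within S)" for w a b x S
    unfolding f_def h_def
    by (rule has_vector_derivative_real_field[unfolded o_def, where f = "\<lambda>z. a * cos (w * z) + b * sin (w * z)"])
       (auto intro!: derivative_eq_intros simp: algebra_simps)
  have h: "(h w a b has_vector_derivative - w\<^sup>2 * f w a b x) (at x within S)" for w a b x S
    unfolding f_def h_def
    by (rule has_vector_derivative_real_field[unfolded o_def, where f = "\<lambda>z. w * (b * cos (w * z) - a * sin (w * z))"])
       (auto intro!: derivative_eq_intros simp: algebra_simps power2_eq_square)
  define \<Phi> :: "real \<Rightarrow> complex^4" where
    "\<Phi> x = vector [f p \<alpha> \<beta> x, f q \<gamma> \<delta> x, h p \<alpha> \<beta> x, h q \<gamma> \<delta> x]" for x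
  show ?L
  proof (rule system_eigenvalueI[where x = 0])
    show "(\<Phi> has_vector_derivative (Bmat (Cmat ap am) l *v \<Phi> x)) (at x within {0..1})" for x
      using f h by (simp add: has_vector_derivative_vec_nth_iff forall_4 Bmat_mult_vector[OF a]
          \<Phi>_def flip: p(2) q(2))
    \<comment> \<open>The initial vector is
      \<open>(\<alpha>, \<gamma>, p * \<beta>, q * \<delta>)\<close>, and neither frequency
      vanishes.\<close>
    show "\<Phi> 0 \<noteq> 0"
      using nz p(1) q(1) by (auto simp: \<Phi>_def vec_eq_iff forall_4 f_def h_def)
    show "Psimat v1 v2 v3 v4 *v \<Phi> 0 = 0" "Psimat v1 v2 v3 v4 *v \<Phi> 1 = 0"
      using e by (simp_all add: Psimat_mult_vector_eq_0_iff \<Phi>_def f_def h_def)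
  qed auto
qed

section \<open>Identification of the determinant with \<open>EV\<close>\<close>

theorem theorem15:
  fixes A :: "complex^2^2" and ap am v1 v2 v3 v4 sp sm l :: complex
  assumes "invertible A"
    and "invertible (Vmat v1 v2 v3 v4)"
    and "A = Vmat v1 v2 v3 v4 ** Cmat ap am ** matrix_inv (Vmat v1 v2 v3 v4)"
    and "sp^2 = ap" and "sm^2 = am"
  shows "system_eigenvalue (Bmat (Cmat ap am)) (Psimat v1 v2 v3 v4) l
         \<longleftrightarrow> EV v1 v2 v3 v4 sp sm l = 0"
proof -
  have V: "v1 * v4 - v2 * v3 \<noteq> 0"
    using assms(2) by (simp add: invertible_det_nz det_Vmat)
  \<comment> \<open>The product \<open>ap * am\<close> is a factor of the nonzero determinant of
    \<open>A\<close>.\<close>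
  have a: "ap \<noteq> 0" "am \<noteq> 0"
    using assms(1,3) by (auto simp: invertible_det_nz det_mul det_Cmat)
  then have s: "sp \<noteq> 0" "sm \<noteq> 0"
    using assms(4,5) by auto
  show ?thesis
  proof (cases "l = 0")
    case True
    then show ?thesis
      using system_eigenvalue_0[OF V a] by (simp add: EV_def)
  next
    case False
    define p q where "p = l / sp" and "q = l / sm"
    have p: "p \<noteq> 0" "p\<^sup>2 = l\<^sup>2 / ap" and q: "q \<noteq> 0" "q\<^sup>2 = l\<^sup>2 / am"
      using False s assms(4,5) by (auto simp: p_def q_def power_divide)
    \<comment> \<open>Since \<open>l\<close> cancels, \<open>EV\<close> can be written in the
      frequencies alone; multiplying by \<open>p * q\<close> then clears the denominators.\<close>
    have ratio: "q / p = sp / sm" "p / q = sm / sp"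
      using False by (auto simp: p_def q_def)
    have "EV v1 v2 v3 v4 sp sm l = 2 * v1 * v2 * v3 * v4 * (1 - cos p * cos q)
        - (v1\<^sup>2 * v4\<^sup>2 * (q / p) + v2\<^sup>2 * v3\<^sup>2 * (p / q)) * sin p * sin q"
      by (simp add: EV_def ratio flip: p_def q_def)
    then have "p * q * EV v1 v2 v3 v4 sp sm l = 2 * v1 * v2 * v3 * v4 * p * q * (1 - cos p * cos q)
        - (v1\<^sup>2 * v4\<^sup>2 * q\<^sup>2 + v2\<^sup>2 * v3\<^sup>2 * p\<^sup>2) * sin p * sin q"
      using p(1) q(1) by (simp add: field_simps power2_eq_square)
    \<comment> \<open>Replacing squared cosines by one minus squared sines in
      \<open>(cos p - cos q)\<^sup>2\<close> leaves squared sines, which cancel those from the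
      product of the two brackets.\<close>
    also have "\<dots> = v1 * v2 * v3 * v4 * p * q * (cos p - cos q)\<^sup>2
        - (v1 * v4 * q * sin p - v2 * v3 * p * sin q) * (v1 * v4 * q * sin q - v2 * v3 * p * sin p)"
      using sin_cos_squared_add[of p] sin_cos_squared_add[of q] by algebra
    finally have "EV v1 v2 v3 v4 sp sm l = 0 \<longleftrightarrow> v1 * v2 * v3 * v4 * p * q * (cos p - cos q)\<^sup>2
        - (v1 * v4 * q * sin p - v2 * v3 * p * sin q) * (v1 * v4 * q * sin q - v2 * v3 * p * sin p) = 0"
      using p(1) q(1) by (metis mult_eq_0_iff)
    then show ?thesis
      unfolding system_eigenvalue_iff[OF p q a] boundary_system_nontrivial_iff[OF V p(1) q(1)]
      by blast
  qed
qed

end
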